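(* Let $d\ge 1$. The space $W_0$ is a $1$-dimensional vector space generated by the polynomial $T_{0\cdots 0}=\operatorname{Tr}(A_0^d)$. The space $W_1$ is a $1$-dimensional vector space generated by the polynomial $T_{10\cdots 0}=\operatorname{Tr}(A_1A_0^{d-1})$.
   Context: Let $A_0=\begin{pmatrix} a_1 & a_2 \\ a_3 & a_4\end{pmatrix}$ and $A_1=\begin{pmatrix} b_1 & b_2 \\ b_3 & b_4\end{pmatrix}$ be generic $2\times 2$ matrices whose entries are the eight variables of the polynomial ring $\mathbb{C}[a_1,\dots,a_4,b_1,\dots,b_4]$. For a binary word $i_1\cdots i_d$ with $i_j\in\{0,1\}$, put $T_{i_1\cdots i_d}:=\operatorname{Tr}(A_{i_1}\cdots A_{i_d})\in\mathbb{C}[a_1,\dots,b_4]$. A binary bracelet of length $d$ is an equivalence class of words in $\{0,1\}^d$ under the dihedral group generated by cyclic rotation and reversal of words. For $2\times2$ matrices $T_{i_1\cdots i_d}$ is invariant under rotation and reversal of the word, so $T_b$ is well defined for a bracelet $b$. $B_w(2,d)$ denotes the set of binary bracelets of length $d$ of weight $w$, meaning that they contain exactly $w$ letters equal to $1$. $W_w:=\langle T_b : b\in B_w(2,d)\rangle$ is the $\mathbb{C}$-linear span of the polynomials $T_b$ with $b \in B_w(2,d)$. *)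

theory Defs
  imports "HOL-Analysis.Analysis" "HOL-Library.Poly_Mapping"
begin

datatype variable = a\<^sub>1 | a\<^sub>2 | a\<^sub>3 | a\<^sub>4 | b\<^sub>1 | b\<^sub>2 | b\<^sub>3 | b\<^sub>4

text \<open>The ring of polynomials over the complex numbers in these eight variables: a polynomial maps
  each monomial (a finitely supported vector of exponents) to its coefficient.\<close>

type_synonym polynomial = "(variable \<Rightarrow>\<^sub>0 nat) \<Rightarrow>\<^sub>0 complex"

definition Var :: "variable \<Rightarrow> polynomial" where
  "Var v = Poly_Mapping.single (Poly_Mapping.single v 1) 1"

definition poly_scale :: "complex \<Rightarrow> polynomial \<Rightarrow> polynomial" where
  "poly_scale c p = Poly_Mapping.single 0 c * p"

lemma lookup_poly_scale: "Poly_Mapping.lookup (poly_scale c p) m = c * Poly_Mapping.lookup p m"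
proof -
  have "poly_scale c p = Poly_Mapping.map ((*) c) p"
    unfolding poly_scale_def by (simp add: mult_map_scale_conv_mult)
  then show ?thesis
    by (simp add: map.rep_eq when_def)
qed

global_interpretation poly: vector_space poly_scale
  by unfold_locales
    (simp_all add: poly_scale_def single_add mult_single distrib_left distrib_right
      flip: mult.assoc)

definition generic_matrix :: "nat \<Rightarrow> polynomial^2^2" where
  "generic_matrix i =
     (if i = 0 then vector [vector [Var a\<^sub>1, Var a\<^sub>2], vector [Var a\<^sub>3, Var a\<^sub>4]]
      else vector [vector [Var b\<^sub>1, Var b\<^sub>2], vector [Var b\<^sub>3, Var b\<^sub>4]])"

definition word_product :: "nat list \<Rightarrow> polynomial^2^2" where
  "word_product u = foldr (\<lambda>i M. generic_matrix i ** M) u (mat 1)"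

definition word_trace :: "nat list \<Rightarrow> polynomial" where
  "word_trace u = trace (word_product u)"

definition mat_power :: "polynomial^2^2 \<Rightarrow> nat \<Rightarrow> polynomial^2^2" where
  "mat_power M n = (((**) M) ^^ n) (mat 1)"

definition binary_words :: "nat \<Rightarrow> nat list set" where
  "binary_words d = {u. length u = d \<and> set u \<subseteq> {0, 1}}"

text \<open>The group of maps on words generated by rotation and reversal. Closure under inverses need not
  be required, since \<open>rev\<close> and \<open>rev \<circ> rotate1 \<circ> rev\<close> are the inverses of \<open>rev\<close> and \<open>rotate1\<close>. The
  induced group of permutations of the words of length \<open>d\<close> is the image of the dihedral group.\<close>

inductive_set dihedral :: "(nat list \<Rightarrow> nat list) set" where
  id: "id \<in> dihedral"
| rotation: "g \<in> dihedral \<Longrightarrow> rotate1 \<circ> g \<in> dihedral"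
| reversal: "g \<in> dihedral \<Longrightarrow> rev \<circ> g \<in> dihedral"

definition bracelet_rel :: "nat \<Rightarrow> (nat list \<times> nat list) set" where
  "bracelet_rel d = {(u, v). u \<in> binary_words d \<and> v \<in> binary_words d \<and> (\<exists>g\<in>dihedral. v = g u)}"

definition bracelets :: "nat \<Rightarrow> nat list set set" where
  "bracelets d = binary_words d // bracelet_rel d"

definition bracelets_of_weight :: "nat \<Rightarrow> nat \<Rightarrow> nat list set set" where
  "bracelets_of_weight w d = {b \<in> bracelets d. \<forall>u\<in>b. count_list u 1 = w}"

text \<open>The common value of \<open>word_trace\<close> on a bracelet; see \<open>bracelet_trace_eq\<close> below.\<close>

definition bracelet_trace :: "nat list set \<Rightarrow> polynomial" where
  "bracelet_trace b = the_elem (word_trace ` b)"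

definition W :: "nat \<Rightarrow> nat \<Rightarrow> polynomial set" where
  "W w d = poly.span (bracelet_trace ` bracelets_of_weight w d)"


subsection \<open>Well-definedness\<close>

lemma dihedral_comp: "g \<in> dihedral \<Longrightarrow> h \<in> dihedral \<Longrightarrow> g \<circ> h \<in> dihedral"
  by (induction rule: dihedral.induct) (auto simp: comp_assoc intro: dihedral.intros)

lemma rev_dihedral: "rev \<in> dihedral"
  using dihedral.reversal[OF dihedral.id] by simp

lemma rotate1_dihedral: "rotate1 \<in> dihedral"
  using dihedral.rotation[OF dihedral.id] by simp

lemma rev_rotate1_rev_rotate1: "rev (rotate1 (rev (rotate1 u))) = u"
  by (cases u) auto

lemma dihedral_inverse: "g \<in> dihedral \<Longrightarrow> \<exists>h\<in>dihedral. h \<circ> g = id"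
proof (induction rule: dihedral.induct)
  case id
  show ?case by (rule bexI[OF _ dihedral.id]) simp
next
  case (rotation g)
  then obtain h where h: "h \<in> dihedral" "h \<circ> g = id" by blast
  have "h \<circ> (rev \<circ> (rotate1 \<circ> rev)) \<in> dihedral"
    by (intro dihedral_comp h rev_dihedral rotate1_dihedral)
  moreover have "(h \<circ> (rev \<circ> (rotate1 \<circ> rev))) \<circ> (rotate1 \<circ> g) = id"
    using h(2) by (simp add: fun_eq_iff rev_rotate1_rev_rotate1)
  ultimately show ?case by blast
next
  case (reversal g)
  then obtain h where h: "h \<in> dihedral" "h \<circ> g = id" by blast
  have "h \<circ> rev \<in> dihedral"
    by (intro dihedral_comp h rev_dihedral)
  moreover have "(h \<circ> rev) \<circ> (rev \<circ> g) = id"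
    using h(2) by (simp add: fun_eq_iff)
  ultimately show ?case by blast
qed

lemma equiv_bracelet_rel: "equiv (binary_words d) (bracelet_rel d)"
proof (rule equivI)
  show "bracelet_rel d \<subseteq> binary_words d \<times> binary_words d"
    by (auto simp: bracelet_rel_def)
  show "refl_on (binary_words d) (bracelet_rel d)"
  proof (rule refl_onI)
    fix u assume "u \<in> binary_words d"
    moreover have "\<exists>g\<in>dihedral. u = g u"
      by (rule bexI[OF _ dihedral.id]) simp
    ultimately show "(u, u) \<in> bracelet_rel d"
      unfolding bracelet_rel_def by blast
  qed
  show "sym (bracelet_rel d)"
    unfolding sym_def bracelet_rel_def
    by clarsimp (metis dihedral_inverse comp_apply id_apply)
  show "trans (bracelet_rel d)"
    unfolding trans_def bracelet_rel_def
    by clarsimp (metis dihedral_comp comp_apply)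
qed

lemma word_product_append: "word_product (u @ v) = word_product u ** word_product v"
  by (induction u) (simp_all add: word_product_def matrix_mul_assoc)

lemma word_trace_rotate1: "word_trace (rotate1 u) = word_trace u"
proof (cases u)
  case (Cons x v)
  have "word_trace (v @ [x]) = word_trace ([x] @ v)"
    unfolding word_trace_def word_product_append by (rule trace_mul_sym)
  then show ?thesis by (simp add: Cons)
qed simp

lemma word_product_rev:
  fixes A B :: "polynomial^2^2"
  defines "A \<equiv> generic_matrix 0" and "B \<equiv> generic_matrix 1"
  shows "\<exists>p q r s. \<forall>i j.
     word_product u $ i $ j = p * mat 1 $ i $ j + q * A $ i $ j + r * B $ i $ j + s * (A ** B) $ i $ j \<and>
     word_product (rev u) $ i $ j = p * mat 1 $ i $ j + q * A $ i $ j + r * B $ i $ j + s * (B ** A) $ i $ j"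
proof (induction u)
  case Nil
  show ?case
    by (rule exI[of _ 1], rule exI[of _ 0], rule exI[of _ 0], rule exI[of _ 0])
      (simp add: word_product_def)
next
  case (Cons x u)
  then obtain p q r s where IH: "\<And>i j. word_product u $ i $ j =
      p * mat 1 $ i $ j + q * A $ i $ j + r * B $ i $ j + s * (A ** B) $ i $ j"
    "\<And>i j. word_product (rev u) $ i $ j =
      p * mat 1 $ i $ j + q * A $ i $ j + r * B $ i $ j + s * (B ** A) $ i $ j"
    by blast
  have step: "word_product (x # u) = generic_matrix x ** word_product u"
    "word_product (rev (x # u)) = word_product (rev u) ** generic_matrix x"
    by (simp_all add: word_product_append) (simp_all add: word_product_def)
  show ?case
  proof (cases "x = 0")
    case True
    then have x: "generic_matrix x = A" by (simp add: A_def)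
    show ?thesis
      unfolding step x
      by (rule exI[of _ "- q * det A"], rule exI[of _ "p + q * trace A"],
          rule exI[of _ "- s * det A"], rule exI[of _ "r + s * trace A"])
        (simp add: matrix_matrix_mult_def IH mat_def forall_2 sum_2 det_2 trace_def algebra_simps)
  next
    case False
    then have x: "generic_matrix x = B" by (simp add: B_def generic_matrix_def)
    define t where "t = trace (A ** B)"
    show ?thesis
      unfolding step x
      by (rule exI[of _ "q * (t - trace A * trace B) - r * det B - s * trace A * det B"],
          rule exI[of _ "q * trace B + s * det B"],
          rule exI[of _ "p + q * trace A + r * trace B + s * t"], rule exI[of _ "- q"])
        (simp add: t_def matrix_matrix_mult_def IH mat_def forall_2 sum_2 det_2 trace_def algebra_simps)
  qed
qed

lemma word_trace_rev: "word_trace (rev u) = word_trace u"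
proof -
  define A B where "A = generic_matrix 0" and "B = generic_matrix 1"
  obtain p q r s where "\<forall>i j.
     word_product u $ i $ j = p * mat 1 $ i $ j + q * A $ i $ j + r * B $ i $ j + s * (A ** B) $ i $ j \<and>
     word_product (rev u) $ i $ j = p * mat 1 $ i $ j + q * A $ i $ j + r * B $ i $ j + s * (B ** A) $ i $ j"
    using word_product_rev[of u] unfolding A_def B_def by blast
  then show ?thesis
    by (simp add: word_trace_def trace_def sum_2 matrix_matrix_mult_def algebra_simps)
qed

lemma word_trace_dihedral: "g \<in> dihedral \<Longrightarrow> word_trace (g u) = word_trace u"
  by (induction rule: dihedral.induct) (simp_all add: word_trace_rotate1 word_trace_rev)

lemma bracelet_trace_eq:
  assumes "b \<in> bracelets d" "u \<in> b"
  shows "bracelet_trace b = word_trace u"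
proof -
  have "word_trace v = word_trace u" if "v \<in> b" for v
  proof -
    from assms(1) obtain x where "b = bracelet_rel d `` {x}"
      unfolding bracelets_def by (rule quotientE)
    with assms(2) that have "(x, u) \<in> bracelet_rel d" "(x, v) \<in> bracelet_rel d"
      by auto
    then obtain g h where "g \<in> dihedral" "u = g x" "h \<in> dihedral" "v = h x"
      unfolding bracelet_rel_def by blast
    then show ?thesis
      using word_trace_dihedral[of g x] word_trace_dihedral[of h x] by simp
  qed
  then have "word_trace ` b = {word_trace u}"
    using assms(2) by blast
  then show ?thesis
    by (simp add: bracelet_trace_def)
qed

end

theory Submission
  imports Defs
begin

text \<open>Each space is spanned by the trace of a single word, because the words of weight \<open>0\<close> or \<open>1\<close>
  form a single rotation class. That trace is nonzero: under the evaluation of all eight variables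
  at \<open>1\<close> both matrices become the all-ones matrix \<open>J\<close>, and \<open>Tr (J ^ d) = 2 ^ d\<close>.\<close>

text \<open>For a \<open>polynomial\<close> this is its value at the point with all variables equal
  to 1, since every monomial takes the value 1 there.\<close>

definition coeff_sum :: "('a \<Rightarrow>\<^sub>0 'b::comm_monoid_add) \<Rightarrow> 'b" where
  "coeff_sum p = (\<Sum>m\<in>Poly_Mapping.keys p. Poly_Mapping.lookup p m)"

lemma coeff_sum_0 [simp]: "coeff_sum 0 = 0"
  by (simp add: coeff_sum_def)

lemma coeff_sum_single [simp]: "coeff_sum (Poly_Mapping.single m c) = c"
  by (simp add: coeff_sum_def)

lemma coeff_sum_1 [simp]: "coeff_sum 1 = 1"
  by (simp flip: single_one)

text \<open>Cancellation can make the support of \<open>p + q\<close> smaller than the union of the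
  supports; padding with zero coefficients lets all three sums run over one index set.\<close>

lemma coeff_sum_superset:
  assumes "finite S" "Poly_Mapping.keys p \<subseteq> S"
  shows "coeff_sum p = (\<Sum>m\<in>S. Poly_Mapping.lookup p m)"
  unfolding coeff_sum_def using assms
  by (intro sum.mono_neutral_left) (auto simp: in_keys_iff)

lemma coeff_sum_add [simp]: "coeff_sum (p + q) = coeff_sum p + coeff_sum q"
proof -
  let ?S = "Poly_Mapping.keys p \<union> Poly_Mapping.keys q"
  have "Poly_Mapping.keys (p + q) \<subseteq> ?S"
    by (rule Poly_Mapping.keys_add)
  then show ?thesis
    by (simp add: coeff_sum_superset[of ?S] lookup_add sum.distrib)
qed

text \<open>Updating at a key outside the support is the same as adding a \<open>single\<close>. In
  this additive form the induction step meets distributivity directly.\<close>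

lemma poly_mapping_add_single_induct [case_names zero add_single]:
  assumes "P 0" "\<And>p m c. P p \<Longrightarrow> P (p + Poly_Mapping.single m c)"
  shows "P (p :: 'a \<Rightarrow>\<^sub>0 'b::comm_monoid_add)"
proof (induction p rule: update_induct)
  case const
  show ?case by fact
next
  case (update p m c)
  then have "Poly_Mapping.update m c p = p + Poly_Mapping.single m c"
    by (intro poly_mapping_eqI)
      (auto simp: lookup_update lookup_add lookup_single in_keys_iff when_def)
  with update assms(2) show ?case by simp
qed

text \<open>By additivity in each factor, two nested inductions reduce the claim to a product of two
  singles, where keys add and coefficients multiply.\<close>

lemma coeff_sum_mult [simp]:
  fixes p q :: "'a::monoid_add \<Rightarrow>\<^sub>0 'b::semiring_0"
  shows "coeff_sum (p * q) = coeff_sum p * coeff_sum q"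
proof (induction p rule: poly_mapping_add_single_induct)
  case (add_single p m c)
  have "coeff_sum (Poly_Mapping.single m c * q) = c * coeff_sum q"
    by (induction q rule: poly_mapping_add_single_induct)
      (simp_all add: distrib_left mult_single)
  with add_single show ?case by (simp add: distrib_right)
qed simp

lemma coeff_sum_generic_matrix: "coeff_sum (generic_matrix x $ i $ j) = 1"
proof -
  have "\<forall>i j. coeff_sum (generic_matrix x $ i $ j) = 1"
    by (simp add: forall_2 generic_matrix_def Var_def)
  then show ?thesis by blast
qed

text \<open>Each further letter contributes a factor 2, because \<open>J ** J\<close> is twice
  \<open>J\<close>. The word must be nonempty: the empty product is the identity, not a multiple of
  \<open>J\<close>.\<close>

lemma coeff_sum_word_product:
  "coeff_sum (word_product (x # u) $ i $ j) = 2 ^ length u"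
proof (induction u arbitrary: x i j)
  case Nil
  show ?case
    by (simp add: word_product_def coeff_sum_generic_matrix)
next
  case (Cons y u)
  have "word_product (x # y # u) = generic_matrix x ** word_product (y # u)"
    by (simp add: word_product_def)
  then show ?case
    by (simp add: matrix_matrix_mult_def sum_2 Cons.IH coeff_sum_generic_matrix)
qed

lemma word_trace_nonzero: "word_trace u \<noteq> 0"
proof (cases u)
  case Nil
  \<comment> \<open>The form \<open>1 + 1\<close>, rather than the numeral 2, lets additivity of
    \<open>coeff_sum\<close> apply.\<close>
  have "word_trace [] = 1 + 1"
    by (simp add: word_trace_def word_product_def trace_def sum_2 mat_def)
  then have "coeff_sum (word_trace []) = 1 + 1"
    by (simp only: coeff_sum_add coeff_sum_1)
  with Nil show ?thesis by auto
next
  case (Cons x v)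
  have "coeff_sum (word_trace u) = 2 ^ length u"
    by (simp add: Cons word_trace_def trace_def sum_2 coeff_sum_word_product)
  then show ?thesis by auto
qed

lemma count_list_rotate1: "count_list (rotate1 u) x = count_list u x"
  by (cases u) auto

lemma count_list_dihedral: "g \<in> dihedral \<Longrightarrow> count_list (g u) x = count_list u x"
  by (induction rule: dihedral.induct) (simp_all add: count_list_rotate1)

text \<open>This removes the quotient from the remaining argument: weight and trace are both
  constant on a class, so any representative will do.\<close>

lemma bracelet_trace_image:
  "bracelet_trace ` bracelets_of_weight w d =
    word_trace ` {u \<in> binary_words d. count_list u 1 = w}"
proof (intro equalityI subsetI)
  fix t assume "t \<in> bracelet_trace ` bracelets_of_weight w d"
  then obtain b where b: "b \<in> bracelets d" "\<forall>u\<in>b. count_list u 1 = w" "t = bracelet_trace b"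
    by (auto simp: bracelets_of_weight_def)
  obtain u where u: "u \<in> binary_words d" "b = bracelet_rel d `` {u}"
    using b(1) unfolding bracelets_def by (rule quotientE)
  then have "u \<in> b"
    using equiv_class_self[OF equiv_bracelet_rel] by simp
  with b u(1) show "t \<in> word_trace ` {u \<in> binary_words d. count_list u 1 = w}"
    by (auto simp: bracelet_trace_eq)
next
  fix t assume "t \<in> word_trace ` {u \<in> binary_words d. count_list u 1 = w}"
  then obtain u where u: "u \<in> binary_words d" "count_list u 1 = w" "t = word_trace u"
    by auto
  let ?b = "bracelet_rel d `` {u}"
  have b: "?b \<in> bracelets d" "u \<in> ?b"
    using u(1) equiv_class_self[OF equiv_bracelet_rel]
    by (auto simp: bracelets_def intro: quotientI)
  moreover have "?b \<in> bracelets_of_weight w d"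
    using b(1) u(2) by (auto simp: bracelets_of_weight_def bracelet_rel_def count_list_dihedral)
  ultimately show "t \<in> bracelet_trace ` bracelets_of_weight w d"
    using u(3) by (metis bracelet_trace_eq image_eqI)
qed

lemma word_trace_append_commute: "word_trace (u @ v) = word_trace (v @ u)"
  unfolding word_trace_def word_product_append by (rule trace_mul_sym)

lemma binary_word_weight_0:
  assumes "u \<in> binary_words d" "count_list u 1 = 0"
  shows "u = replicate d 0"
  using assms by (auto simp: binary_words_def count_list_0_iff intro!: replicate_eqI)

lemma word_trace_weight_1:
  assumes "u \<in> binary_words d" "count_list u 1 = 1"
  shows "word_trace u = word_trace (1 # replicate (d - 1) 0)"
proof -
  obtain v w where u: "u = v @ 1 # w"
    using assms(2) by (metis count_notin split_list zero_neq_one)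
  \<comment> \<open>Rotating the only 1 to the front leaves \<open>w @ v\<close> behind it, a word
    of weight 0.\<close>
  have "w @ v \<in> binary_words (d - 1)" "count_list (w @ v) 1 = 0"
    using assms by (auto simp: u binary_words_def)
  then have "w @ v = replicate (d - 1) 0"
    by (rule binary_word_weight_0)
  then show ?thesis
    using word_trace_append_commute[of v "1 # w"] by (simp add: u)
qed

lemma W_eq_span:
  assumes "u \<in> binary_words d" "count_list u 1 = w"
    and "\<And>v. v \<in> binary_words d \<Longrightarrow> count_list v 1 = w \<Longrightarrow> word_trace v = word_trace u"
  shows "W w d = poly.span {word_trace u}"
proof -
  have "word_trace ` {v \<in> binary_words d. count_list v 1 = w} = {word_trace u}"
    using assms by blast
  then show ?thesis
    by (simp add: W_def bracelet_trace_image)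
qed

text \<open>A single nonzero vector is linearly independent.\<close>

lemma dim_span_word_trace: "poly.dim (poly.span {word_trace u}) = 1"
  by (subst poly.dim_span_eq_card_independent) (simp_all add: word_trace_nonzero)

lemma word_product_replicate: "word_product (replicate n x) = mat_power (generic_matrix x) n"
  by (induction n) (simp_all add: word_product_def mat_power_def)

theorem proposition4p9:
  fixes d :: nat
  assumes "d \<ge> 1"
  shows "poly.dim (W 0 d) = 1 \<and>
         W 0 d = poly.span {word_trace (replicate d 0)} \<and>
         word_trace (replicate d 0) = trace (mat_power (generic_matrix 0) d) \<and>
         poly.dim (W 1 d) = 1 \<and>
         W 1 d = poly.span {word_trace (1 # replicate (d - 1) 0)} \<and>
         word_trace (1 # replicate (d - 1) 0) =
           trace (generic_matrix 1 ** mat_power (generic_matrix 0) (d - 1))"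
proof -
  have W0: "W 0 d = poly.span {word_trace (replicate d 0)}"
  proof (rule W_eq_span)
    show "word_trace v = word_trace (replicate d 0)"
      if "v \<in> binary_words d" "count_list v 1 = 0" for v
      using binary_word_weight_0[OF that] by simp
  qed (auto simp: binary_words_def count_list_0_iff)
  have W1: "W 1 d = poly.span {word_trace (1 # replicate (d - 1) 0)}"
    \<comment> \<open>From \<open>d \<ge> 1\<close>, the word \<open>1 # replicate (d - 1) 0\<close>
      has length \<open>d\<close>; at \<open>d = 0\<close> truncated subtraction would give length
      1.\<close>
    using assms
    by (intro W_eq_span word_trace_weight_1) (auto simp: binary_words_def count_list_0_iff)
  have "word_trace (1 # replicate (d - 1) 0) =
      trace (generic_matrix 1 ** mat_power (generic_matrix 0) (d - 1))"
    by (simp add: word_trace_def word_product_def flip: word_product_replicate)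
  moreover have "word_trace (replicate d 0) = trace (mat_power (generic_matrix 0) d)"
    by (simp add: word_trace_def word_product_replicate)
  moreover have "poly.dim (W 0 d) = 1" "poly.dim (W 1 d) = 1"
    unfolding W0 W1 by (rule dim_span_word_trace)+
  ultimately show ?thesis
    using W0 W1 by blast
qed

end
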